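(* Let $(A,\mu,\alpha)$ be a Hom-alternative algebra over $\mathbf{k}$, and write $ab=\mu(a,b)$. Then for all $x,y,z\in A$: $$((xy)\alpha(x))\alpha^2(z)=\alpha^2(x)(\alpha(y)(xz)),$$ $$((zx)\alpha(y))\alpha^2(x)=\alpha^2(z)(\alpha(x)(yx)),$$ $$\alpha((xy)(zx))=\alpha^2(x)((yz)\alpha(x)).$$
   Context: $\mathbf{k}$ is a fixed field of characteristic $0$; all modules, linear maps and tensor products are over $\mathbf{k}$. A Hom-algebra is a triple $(A,\mu,\alpha)$ with $A$ a $\mathbf{k}$-module, $\mu\colon A\otimes A\to A$ bilinear (not necessarily associative or unital), and $\alpha\colon A\to A$ linear with $\alpha(\mu(x,y))=\mu(\alpha(x),\alpha(y))$ for all $x,y$. The Hom-associator is $as_A(x,y,z)=\mu(\mu(x,y),\alpha(z))-\mu(\alpha(x),\mu(y,z))$. $A$ is Hom-alternative if $as_A$ is alternating (changes by the sign of the permutation when its arguments are permuted). Here $\alpha^2=\alpha\circ\alpha$. *)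

theory Defs
  imports Complex_Main "HOL-Combinatorics.Permutations"
begin

text \<open>A bilinear multiplication \<open>mu\<close> is the same as a linear map \<open>A \<otimes> A \<rightarrow> A\<close>.\<close>

locale hom_algebra = vector_space scale
  for scale :: "'k::field_char_0 \<Rightarrow> 'a::ab_group_add \<Rightarrow> 'a" +
  fixes mu :: "'a \<Rightarrow> 'a \<Rightarrow> 'a"
    and alpha :: "'a \<Rightarrow> 'a"
  assumes linear_mu_left: "Vector_Spaces.linear scale scale (\<lambda>x. mu x y)"
    and linear_mu_right: "Vector_Spaces.linear scale scale (\<lambda>y. mu x y)"
    and linear_alpha: "Vector_Spaces.linear scale scale alpha"
    and alpha_mu: "alpha (mu x y) = mu (alpha x) (alpha y)"

definition hom_associator ::
  "('a::ab_group_add \<Rightarrow> 'a \<Rightarrow> 'a) \<Rightarrow> ('a \<Rightarrow> 'a) \<Rightarrow> 'a \<Rightarrow> 'a \<Rightarrow> 'a \<Rightarrow> 'a" where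
  "hom_associator mu alpha x y z = mu (mu x y) (alpha z) - mu (alpha x) (mu y z)"

text \<open>The three arguments are encoded as the values \<open>v 1\<close>, \<open>v 2\<close>, \<open>v 3\<close> of a family \<open>v\<close>.\<close>

definition alternating3 ::
  "('k::field_char_0 \<Rightarrow> 'a::ab_group_add \<Rightarrow> 'a) \<Rightarrow> ('a \<Rightarrow> 'a \<Rightarrow> 'a \<Rightarrow> 'a) \<Rightarrow> bool" where
  "alternating3 scale f \<longleftrightarrow>
     (\<forall>(v :: nat \<Rightarrow> 'a) p. p permutes {1, 2, 3} \<longrightarrow>
        f (v (p 1)) (v (p 2)) (v (p 3)) = scale (of_int (sign p)) (f (v 1) (v 2) (v 3)))"

locale hom_alternative_algebra = hom_algebra scale mu alpha
  for scale :: "'k::field_char_0 \<Rightarrow> 'a::ab_group_add \<Rightarrow> 'a"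
    and mu :: "'a \<Rightarrow> 'a \<Rightarrow> 'a"
    and alpha :: "'a \<Rightarrow> 'a" +
  assumes alternating: "alternating3 scale (hom_associator mu alpha)"

end

theory Submission
  imports Defs
begin

text \<open>
  Each Moufang identity compares two ways of bracketing a product, and re-bracketing costs
  associators.  For the first two identities the cost is a sum of two associators having one
  product among their arguments; for the third it is one such associator minus
  \<open>\<alpha>\<^sup>2(x) as(y,z,x)\<close>.  Everything therefore reduces to a derivation-like rule
  for pulling a repeated factor out of an associator:
  \<open>as(xy, \<alpha>(x), \<alpha>(z)) = as(y,x,z) \<alpha>\<^sup>2(x)\<close> and
  \<open>as(zx, \<alpha>(x), \<alpha>(y)) = \<alpha>\<^sup>2(x) as(x,y,z)\<close>
  (lemmas \<open>associator_extract_right\<close> and \<open>associator_extract_left\<close>).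
  By these rules the two associators of the first and of the second identity are opposite,
  and the two terms of the third cancel.

  The extraction rules say that a Hom-version of the Bruck--Kleinfeld function vanishes when
  two of its arguments coincide.  They follow from the pentagon relation
  \<open>hom_teichmuller\<close>, which holds in every Hom-algebra, specialised at three quadruples in
  which \<open>x\<close> occurs twice.  Alternativity kills the degenerate terms, and the remaining linear
  system determines both associators.
\<close>

context hom_algebra
begin

notation mu (infixl "\<cdot>" 70)

abbreviation as :: "'a \<Rightarrow> 'a \<Rightarrow> 'a \<Rightarrow> 'a" where
  "as \<equiv> hom_associator mu alpha"

lemma mu_diff_left: "(x - y) \<cdot> z = x \<cdot> z - y \<cdot> z"
  by (rule module_hom.diff[OF linear_mu_left[THEN module_hom_linearI]])

lemma mu_diff_right: "x \<cdot> (y - z) = x \<cdot> y - x \<cdot> z"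
  by (rule module_hom.diff[OF linear_mu_right[THEN module_hom_linearI]])

lemma mu_minus_right: "x \<cdot> (- y) = - (x \<cdot> y)"
  by (rule module_hom.neg[OF linear_mu_right[THEN module_hom_linearI]])

lemma mu_minus_left: "(- x) \<cdot> y = - (x \<cdot> y)"
  by (rule module_hom.neg[OF linear_mu_left[THEN module_hom_linearI]])

lemma mu_zero_right: "x \<cdot> 0 = 0"
  by (rule module_hom.zero[OF linear_mu_right[THEN module_hom_linearI]])

lemma mu_zero_left: "0 \<cdot> x = 0"
  by (rule module_hom.zero[OF linear_mu_left[THEN module_hom_linearI]])

text \<open>The pentagon relation: a product of four factors has five bracketings, and each of the
  five associators is the difference of two neighbouring ones, so the signed sum telescopes.
  Multiplicativity of \<open>\<alpha>\<close> is what makes neighbouring twisted bracketings agree.\<close>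

lemma hom_teichmuller:
  "as (w \<cdot> x) (alpha y) (alpha z) - as (alpha w) (x \<cdot> y) (alpha z) + as (alpha w) (alpha x) (y \<cdot> z)
    = alpha (alpha w) \<cdot> as x y z + as w x y \<cdot> alpha (alpha z)"
  by (simp add: hom_associator_def mu_diff_left mu_diff_right alpha_mu)

end

context hom_alternative_algebra
begin

text \<open>The two adjacent transpositions generate all permutations of the arguments, so the
  symmetries of the associator are derived from these two rules.\<close>

lemma associator_swap12: "as x y z = - as y x z"
proof -
  define v :: "nat \<Rightarrow> 'a" where "v i = (if i = 1 then x else if i = 2 then y else z)" for i
  have "transpose (1::nat) 2 permutes {1, 2, 3}"
    by (rule permutes_swap_id) auto
  with alternating have "as (v (transpose 1 2 1)) (v (transpose 1 2 2)) (v (transpose 1 2 3))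
      = scale (of_int (sign (transpose (1::nat) 2))) (as (v 1) (v 2) (v 3))"
    unfolding alternating3_def by blast
  then show ?thesis
    by (simp add: v_def sign_swap_id transpose_def)
qed

lemma associator_swap23: "as x y z = - as x z y"
proof -
  define v :: "nat \<Rightarrow> 'a" where "v i = (if i = 1 then x else if i = 2 then y else z)" for i
  have "transpose (2::nat) 3 permutes {1, 2, 3}"
    by (rule permutes_swap_id) auto
  with alternating have "as (v (transpose 2 3 1)) (v (transpose 2 3 2)) (v (transpose 2 3 3))
      = scale (of_int (sign (transpose (2::nat) 3))) (as (v 1) (v 2) (v 3))"
    unfolding alternating3_def by blast
  then show ?thesis
    by (simp add: v_def sign_swap_id transpose_def)
qed

lemma associator_cycle: "as x y z = as z x y"
  by (metis associator_swap12 associator_swap23 minus_minus)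

text \<open>A skew-symmetric map vanishes on repeated arguments because 2 is invertible in the field.\<close>

lemma self_neg_imp_zero:
  assumes "a = - (a::'a)"
  shows "a = 0"
proof -
  have "scale 2 a = scale 1 a + scale 1 a"
    by (simp only: scale_left_distrib[symmetric] one_add_one)
  also have "\<dots> = 0"
    using assms by (simp add: eq_neg_iff_add_eq_0)
  finally show ?thesis by simp
qed

lemma associator_repeat12: "as x x y = 0"
  using associator_swap12 by (rule self_neg_imp_zero)

lemma associator_repeat23: "as x y y = 0"
  using associator_swap23 by (rule self_neg_imp_zero)

text \<open>Alternativity lets the product argument of each associator in the pentagon relation be
  moved to the front; the minus sign there is absorbed by a transposition.\<close>

lemma hom_teichmuller_front:
  "as (w \<cdot> x) (alpha y) (alpha z) + as (x \<cdot> y) (alpha w) (alpha z) + as (y \<cdot> z) (alpha w) (alpha x)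
    = alpha (alpha w) \<cdot> as x y z + as w x y \<cdot> alpha (alpha z)"
  using hom_teichmuller[of w x y z] associator_swap12[of "alpha w" "x \<cdot> y" "alpha z"]
    associator_cycle[of "alpha w" "alpha x" "y \<cdot> z"]
  by simp

text \<open>The quadruple \<open>(x,x,y,z)\<close> relates \<open>as(xy,\<alpha>(x),\<alpha>(z))\<close> to
  \<open>as(xx,\<alpha>(y),\<alpha>(z))\<close>, and \<open>(z,x,x,y)\<close> brings in
  \<open>as(zx,\<alpha>(x),\<alpha>(y))\<close> without any right-hand side.  Adding them eliminates the
  other two associators.\<close>

lemma associator_extract_left:
  "as (z \<cdot> x) (alpha x) (alpha y) = alpha (alpha x) \<cdot> as x y z"
proof -
  have "as (x \<cdot> x) (alpha y) (alpha z) + as (x \<cdot> y) (alpha x) (alpha z)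
      = alpha (alpha x) \<cdot> as x y z"
    using hom_teichmuller_front[of x x y z]
    by (simp add: associator_repeat12 associator_repeat23 mu_zero_left)
  moreover have "as (z \<cdot> x) (alpha x) (alpha y) - as (x \<cdot> x) (alpha y) (alpha z)
      - as (x \<cdot> y) (alpha x) (alpha z) = 0"
    using hom_teichmuller_front[of z x x y] associator_swap23[of "x \<cdot> x" "alpha z" "alpha y"]
      associator_swap23[of "x \<cdot> y" "alpha z" "alpha x"]
    by (simp add: associator_repeat12 associator_repeat23 mu_zero_left mu_zero_right)
  ultimately show ?thesis
    by (simp add: algebra_simps)
qed

text \<open>The quadruple \<open>(x,y,z,x)\<close> relates the two associators to be extracted, so this rule
  follows from the previous one.\<close>

lemma associator_extract_right:
  "as (x \<cdot> y) (alpha x) (alpha z) = as y x z \<cdot> alpha (alpha x)"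
proof -
  have "as (z \<cdot> x) (alpha x) (alpha y) - as (x \<cdot> y) (alpha x) (alpha z)
      = alpha (alpha x) \<cdot> as x y z + as x y z \<cdot> alpha (alpha x)"
    using hom_teichmuller_front[of x y z x] associator_swap23[of "x \<cdot> y" "alpha z" "alpha x"]
    by (simp add: associator_repeat23 associator_cycle[of y z x])
  then have "- as (x \<cdot> y) (alpha x) (alpha z) = as x y z \<cdot> alpha (alpha x)"
    by (simp add: associator_extract_left)
  then show ?thesis
    by (metis associator_swap12 mu_minus_left minus_minus)
qed

lemma hom_moufang_left:
  "((x \<cdot> y) \<cdot> alpha x) \<cdot> alpha (alpha z) = alpha (alpha x) \<cdot> (alpha y \<cdot> (x \<cdot> z))"
proof -
  have "as (alpha x) (alpha y) (x \<cdot> z) = as (x \<cdot> z) (alpha x) (alpha y)"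
    by (rule associator_cycle)
  also have "\<dots> = as z x y \<cdot> alpha (alpha x)"
    by (rule associator_extract_right)
  also have "as z x y = - as y x z"
    by (metis associator_swap12 associator_cycle)
  finally have "as (x \<cdot> y) (alpha x) (alpha z) + as (alpha x) (alpha y) (x \<cdot> z) = 0"
    by (simp add: associator_extract_right mu_minus_left)
  then show ?thesis
    by (simp add: hom_associator_def alpha_mu)
qed

lemma hom_moufang_right:
  "((z \<cdot> x) \<cdot> alpha y) \<cdot> alpha (alpha x) = alpha (alpha z) \<cdot> (alpha x \<cdot> (y \<cdot> x))"
proof -
  have "as (z \<cdot> x) (alpha y) (alpha x) = - (alpha (alpha x) \<cdot> as x y z)"
    by (metis associator_swap23 associator_extract_left)
  moreover have "as (alpha z) (alpha x) (y \<cdot> x) = - as (y \<cdot> x) (alpha x) (alpha z)"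
    by (metis associator_swap23 associator_cycle)
  then have "as (alpha z) (alpha x) (y \<cdot> x) = alpha (alpha x) \<cdot> as x y z"
    by (simp add: associator_extract_left associator_swap23[of x z y] mu_minus_right)
  ultimately have "as (z \<cdot> x) (alpha y) (alpha x) + as (alpha z) (alpha x) (y \<cdot> x) = 0"
    by simp
  then show ?thesis
    by (simp add: hom_associator_def alpha_mu)
qed

lemma hom_moufang_middle:
  "alpha ((x \<cdot> y) \<cdot> (z \<cdot> x)) = alpha (alpha x) \<cdot> ((y \<cdot> z) \<cdot> alpha x)"
proof -
  have "as (alpha x) (alpha y) (z \<cdot> x) = as (z \<cdot> x) (alpha x) (alpha y)"
    by (rule associator_cycle)
  also have "\<dots> = alpha (alpha x) \<cdot> as y z x"
    by (simp add: associator_extract_left associator_cycle[of y z x])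
  finally show ?thesis
    by (simp add: hom_associator_def alpha_mu mu_diff_right)
qed

end

theorem theorem6p8:
  fixes scale :: "'k::field_char_0 \<Rightarrow> 'a::ab_group_add \<Rightarrow> 'a"
    and mu :: "'a \<Rightarrow> 'a \<Rightarrow> 'a" (infixl "\<cdot>" 70)
    and alpha :: "'a \<Rightarrow> 'a"
    and x y z :: 'a
  assumes "hom_alternative_algebra scale mu alpha"
  shows "((x \<cdot> y) \<cdot> alpha x) \<cdot> (alpha ^^ 2) z = (alpha ^^ 2) x \<cdot> (alpha y \<cdot> (x \<cdot> z)) \<and>
    ((z \<cdot> x) \<cdot> alpha y) \<cdot> (alpha ^^ 2) x = (alpha ^^ 2) z \<cdot> (alpha x \<cdot> (y \<cdot> x)) \<and>
    alpha ((x \<cdot> y) \<cdot> (z \<cdot> x)) = (alpha ^^ 2) x \<cdot> ((y \<cdot> z) \<cdot> alpha x)"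
proof -
  interpret hom_alternative_algebra scale mu alpha by fact
  show ?thesis
    using hom_moufang_left hom_moufang_right hom_moufang_middle
    by (simp add: numeral_2_eq_2)
qed

end
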